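(* Let $\mathcal{T}=(V,E)$ be a staged tree with $n$ root-to-leaf paths, let $\mathcal{M}_{\mathcal{T}}$ be the staged tree model it represents, and let $I_{\mathcal{T}}\subseteq\mathbb{R}[p_1,\ldots,p_n]$ be its ideal of model invariants. Then $$\mathcal{M}_{\mathcal{T}}=\mathrm{V}(I_{\mathcal{T}})\cap\Delta_{n-1}^\circ .$$
   Context: A tree $\mathcal{T}=(V,E)$ is a finite directed rooted tree with root $v_0$ and at least one edge, edges directed away from the root, in which every vertex has either no or at least two outgoing edges. $E(v)\subseteq E$ is the set of edges going out of $v$. A staged tree is such a tree together with an edge labelling $e\mapsto\theta(e)$ and an equivalence relation $\sim$ on the non-leaf vertices ($v\sim w$ is read "$v$ and $w$ are in the same stage"), such that the edges out of one vertex have pairwise distinct labels, the sets of labels on $E(v)$ and $E(w)$ coincide if $v\sim w$, and these sets are disjoint if $v\not\sim w$. The parameter space $\Theta_{\mathcal{T}}$ is the set of all assignments of real values in $(0,1)$ to the labels (the same label always receiving the same value) such that $\sum_{e\in E(v)}\theta(e)=1$ for every non-leaf vertex $v$. Number the root-to-leaf paths $\lambda_1,\ldots,\lambda_n$ and let $E(\lambda_i)$ be the set of edges of $\lambda_i$. The staged tree model is $$\mathcal{M}_{\mathcal{T}}=\Bigl\{\Bigl(\prod_{e\in E(\lambda_1)}\theta(e),\ldots,\prod_{e\in E(\lambda_n)}\theta(e)\Bigr)\;\Big|\;\theta\in\Theta_{\mathcal{T}}\Bigr\}\subseteq\mathbb{R}^n .$$ For $v\in V$ let $[v]\subseteq\{1,\ldots,n\}$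 be the set of indices $i$ such that $\lambda_i$ passes through $v$, and let $p_{[v]}=\sum_{i\in[v]}p_i\in\mathbb{R}[p_1,\ldots,p_n]$. The ideal of model invariants is $$I_{\mathcal{T}}=\bigl\langle p_{[v]}p_{[w']}-p_{[v']}p_{[w]}\;\big|\; v\sim w,\ (v,v')\in E(v)\text{ and }(w,w')\in E(w)\text{ with the same label}\bigr\rangle .$$ $\mathrm{V}(I)=\{x\in\mathbb{R}^n\mid f(x)=0\text{ for all }f\in I\}$, and $\Delta_{n-1}^\circ=\{x\in\mathbb{R}^n\mid \sum_{i=1}^n x_i=1,\ 0<x_i<1\text{ for all }i\}$. *)

theory Defs
  imports Complex_Main "HOL-Library.FuncSet" "HOL-Library.Poly_Mapping"
    "HOL-Algebra.RingHom" "Graph_Theory.Arc_Walk"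
begin

section \<open>Polynomials in finitely many variables\<close>

text \<open>
  A monomial is its finitely supported exponent function and a polynomial is its finitely supported
  coefficient function; addition and multiplication are those of \<^theory>\<open>HOL-Library.Poly_Mapping\<close>
  (multiplication is convolution). The variables of \<open>\<real>[p\<^sub>1,\<dots>,p\<^sub>n]\<close> are numbered \<open>1,\<dots>,n\<close>.
\<close>

type_synonym rpoly = "(nat \<Rightarrow>\<^sub>0 nat) \<Rightarrow>\<^sub>0 real"

definition var :: "nat \<Rightarrow> rpoly" where
  "var i = Poly_Mapping.single (Poly_Mapping.single i 1) 1"

definition poly_ring :: "nat \<Rightarrow> rpoly ring" where
  "poly_ring n = \<lparr>carrier = {f. \<forall>m \<in> Poly_Mapping.keys f. Poly_Mapping.keys m \<subseteq> {1..n}},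
     monoid.mult = (*), one = 1, zero = 0, add = (+)\<rparr>"

definition monom_eval :: "(nat \<Rightarrow> real) \<Rightarrow> (nat \<Rightarrow>\<^sub>0 nat) \<Rightarrow> real" where
  "monom_eval x m = (\<Prod>i\<in>Poly_Mapping.keys m. x i ^ Poly_Mapping.lookup m i)"

definition poly_eval :: "(nat \<Rightarrow> real) \<Rightarrow> rpoly \<Rightarrow> real" where
  "poly_eval x f = (\<Sum>m\<in>Poly_Mapping.keys f. Poly_Mapping.lookup f m * monom_eval x m)"

text \<open>Points of \<open>\<real>\<^sup>n\<close> are functions on \<open>{1..n}\<close>, extended by \<open>undefined\<close>.\<close>

definition variety :: "nat \<Rightarrow> rpoly set \<Rightarrow> (nat \<Rightarrow> real) set" where
  "variety n I = {x \<in> {1..n} \<rightarrow>\<^sub>E UNIV. \<forall>f\<in>I. poly_eval x f = 0}"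

definition open_simplex :: "nat \<Rightarrow> (nat \<Rightarrow> real) set" where
  "open_simplex n = {x \<in> {1..n} \<rightarrow>\<^sub>E UNIV. (\<Sum>i=1..n. x i) = 1 \<and> (\<forall>i\<in>{1..n}. 0 < x i \<and> x i < 1)}"

section \<open>Staged trees\<close>

text \<open>
  The constant \<open>tree\<close> of the session \<open>Graph_Theory\<close> only excludes directed cycles, hence the
  definition of a rooted tree by unique walks from the root.
\<close>

locale rooted_tree = fin_digraph T for T :: "('v, 'e) pre_digraph" +
  fixes v0 :: 'v
  assumes root_in_verts: "v0 \<in> verts T"
    and unique_awalk: "v \<in> verts T \<Longrightarrow> \<exists>!p. pre_digraph.awalk T v0 p v"

definition non_leaves :: "('v, 'e) pre_digraph \<Rightarrow> 'v set" where
  "non_leaves T = {v \<in> verts T. out_arcs T v \<noteq> {}}"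

locale staged_tree = rooted_tree T v0 for T :: "('v, 'e) pre_digraph" and v0 :: 'v +
  fixes label :: "'e \<Rightarrow> 'l" and stage :: "('v \<times> 'v) set"
  assumes arcs_nonempty: "arcs T \<noteq> {}"
    and out_degree: "v \<in> verts T \<Longrightarrow> out_degree T v = 0 \<or> out_degree T v \<ge> 2"
    and equiv_stage: "equiv (non_leaves T) stage"
    and inj_label: "v \<in> non_leaves T \<Longrightarrow> inj_on label (out_arcs T v)"
    and same_stage: "(v, w) \<in> stage \<Longrightarrow> label ` out_arcs T v = label ` out_arcs T w"
    and other_stage: "v \<in> non_leaves T \<Longrightarrow> w \<in> non_leaves T \<Longrightarrow> (v, w) \<notin> stage \<Longrightarrow>
      label ` out_arcs T v \<inter> label ` out_arcs T w = {}"

definition root_leaf_paths :: "('v, 'e) pre_digraph \<Rightarrow> 'v \<Rightarrow> 'e awalk set" where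
  "root_leaf_paths T v0 = {p. \<exists>l \<in> verts T - non_leaves T. pre_digraph.awalk T v0 p l}"

section \<open>The model and its invariants\<close>

text \<open>In the following, \<open>walk\<close> numbers the root-to-leaf paths by \<open>{1..n}\<close>.\<close>

definition parameter_space :: "('v, 'e) pre_digraph \<Rightarrow> ('e \<Rightarrow> 'l) \<Rightarrow> ('l \<Rightarrow> real) set" where
  "parameter_space T label =
     {\<theta> \<in> label ` arcs T \<rightarrow>\<^sub>E {0<..<1}. \<forall>v \<in> non_leaves T. (\<Sum>e\<in>out_arcs T v. \<theta> (label e)) = 1}"

definition staged_tree_model ::
    "('v, 'e) pre_digraph \<Rightarrow> ('e \<Rightarrow> 'l) \<Rightarrow> nat \<Rightarrow> (nat \<Rightarrow> 'e awalk) \<Rightarrow> (nat \<Rightarrow> real) set" where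
  "staged_tree_model T label n walk =
     {\<lambda>i\<in>{1..n}. \<Prod>e\<in>set (walk i). \<theta> (label e) | \<theta>. \<theta> \<in> parameter_space T label}"

definition paths_through ::
    "('v, 'e) pre_digraph \<Rightarrow> 'v \<Rightarrow> nat \<Rightarrow> (nat \<Rightarrow> 'e awalk) \<Rightarrow> 'v \<Rightarrow> nat set" where
  "paths_through T v0 n walk v =
     {i \<in> {1..n}. v \<in> set (pre_digraph.awalk_verts T v0 (walk i))}"

definition vertex_poly ::
    "('v, 'e) pre_digraph \<Rightarrow> 'v \<Rightarrow> nat \<Rightarrow> (nat \<Rightarrow> 'e awalk) \<Rightarrow> 'v \<Rightarrow> rpoly" where
  "vertex_poly T v0 n walk v = (\<Sum>i\<in>paths_through T v0 n walk v. var i)"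

definition invariant_ideal ::
    "('v, 'e) pre_digraph \<Rightarrow> 'v \<Rightarrow> ('e \<Rightarrow> 'l) \<Rightarrow> ('v \<times> 'v) set \<Rightarrow> nat \<Rightarrow> (nat \<Rightarrow> 'e awalk) \<Rightarrow> rpoly set"
  where
  "invariant_ideal T v0 label stage n walk =
     (let p = vertex_poly T v0 n walk in
      genideal (poly_ring n)
        {p v * p (head T f) - p (head T e) * p w | v w e f.
           (v, w) \<in> stage \<and> e \<in> out_arcs T v \<and> f \<in> out_arcs T w \<and> label e = label f})"

section \<open>Basic facts\<close>

lemma poly_ring_cring: "cring (poly_ring n)"
proof (rule cringI)
  show "abelian_group (poly_ring n)"
  proof (rule abelian_groupI)
    fix f assume f: "f \<in> carrier (poly_ring n)"
    then have "- f \<in> carrier (poly_ring n)"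
      by (simp add: poly_ring_def)
    moreover have "- f \<oplus>\<^bsub>poly_ring n\<^esub> f = \<zero>\<^bsub>poly_ring n\<^esub>"
      by (simp add: poly_ring_def)
    ultimately show "\<exists>g\<in>carrier (poly_ring n). g \<oplus>\<^bsub>poly_ring n\<^esub> f = \<zero>\<^bsub>poly_ring n\<^esub>"
      by blast
  qed (use keys_add in \<open>fastforce simp: poly_ring_def algebra_simps\<close>)+
  show "comm_monoid (poly_ring n)"
  proof (rule comm_monoidI)
    fix f g assume fg: "f \<in> carrier (poly_ring n)" "g \<in> carrier (poly_ring n)"
    have "Poly_Mapping.keys m \<subseteq> {1..n}" if m: "m \<in> Poly_Mapping.keys (f * g)" for m
    proof -
      from m keys_mult[of f g] obtain a b where
        ab: "m = a + b" "a \<in> Poly_Mapping.keys f" "b \<in> Poly_Mapping.keys g"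
        by blast
      have "Poly_Mapping.keys m \<subseteq> Poly_Mapping.keys a \<union> Poly_Mapping.keys b"
        unfolding ab(1) by (rule keys_add)
      moreover have "Poly_Mapping.keys a \<subseteq> {1..n}" "Poly_Mapping.keys b \<subseteq> {1..n}"
        using ab fg by (simp_all add: poly_ring_def)
      ultimately show ?thesis by blast
    qed
    then show "f \<otimes>\<^bsub>poly_ring n\<^esub> g \<in> carrier (poly_ring n)"
      by (auto simp: poly_ring_def)
  qed (auto simp: poly_ring_def algebra_simps)
qed (auto simp: poly_ring_def algebra_simps)

lemma monom_eval_superset:
  assumes "finite K" "Poly_Mapping.keys m \<subseteq> K"
  shows "monom_eval x m = (\<Prod>i\<in>K. x i ^ Poly_Mapping.lookup m i)"
  unfolding monom_eval_def
  using assms by (intro prod.mono_neutral_left) (auto simp: in_keys_iff)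

lemma monom_eval_add: "monom_eval x (a + b) = monom_eval x a * monom_eval x b"
proof -
  let ?K = "Poly_Mapping.keys a \<union> Poly_Mapping.keys b"
  have "monom_eval x (a + b) = (\<Prod>i\<in>?K. x i ^ Poly_Mapping.lookup (a + b) i)"
    by (rule monom_eval_superset) (auto simp: keys_add)
  also have "\<dots> = (\<Prod>i\<in>?K. x i ^ Poly_Mapping.lookup a i) * (\<Prod>i\<in>?K. x i ^ Poly_Mapping.lookup b i)"
    by (simp add: lookup_add power_add prod.distrib)
  also have "\<dots> = monom_eval x a * monom_eval x b"
    using monom_eval_superset[of ?K a x] monom_eval_superset[of ?K b x] by simp
  finally show ?thesis .
qed

lemma poly_eval_superset:
  assumes "finite K" "Poly_Mapping.keys f \<subseteq> K"
  shows "poly_eval x f = (\<Sum>m\<in>K. Poly_Mapping.lookup f m * monom_eval x m)"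
  unfolding poly_eval_def
  using assms by (intro sum.mono_neutral_left) (auto simp: in_keys_iff)

lemma poly_eval_add: "poly_eval x (f + g) = poly_eval x f + poly_eval x g"
proof -
  let ?K = "Poly_Mapping.keys f \<union> Poly_Mapping.keys g"
  have "poly_eval x (f + g) = (\<Sum>m\<in>?K. Poly_Mapping.lookup (f + g) m * monom_eval x m)"
    by (rule poly_eval_superset) (auto simp: keys_add)
  also have "\<dots> = poly_eval x f + poly_eval x g"
    using poly_eval_superset[of ?K f x] poly_eval_superset[of ?K g x]
    by (simp add: lookup_add algebra_simps sum.distrib)
  finally show ?thesis .
qed

lemma poly_eval_0: "poly_eval x 0 = 0"
  by (simp add: poly_eval_def)

lemma poly_eval_1: "poly_eval x 1 = 1"
  by (simp add: poly_eval_def monom_eval_def lookup_one)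

lemma poly_eval_single: "poly_eval x (Poly_Mapping.single m c) = c * monom_eval x m"
  by (simp add: poly_eval_def)

lemma poly_eval_var: "poly_eval x (var i) = x i"
  by (simp add: var_def poly_eval_single monom_eval_def)

lemma poly_eval_sum: "poly_eval x (\<Sum>a\<in>A. f a) = (\<Sum>a\<in>A. poly_eval x (f a))"
  by (induction A rule: infinite_finite_induct) (simp_all add: poly_eval_0 poly_eval_add)

lemma rpoly_expansion:
  "(f :: rpoly) = (\<Sum>m\<in>Poly_Mapping.keys f. Poly_Mapping.single m (Poly_Mapping.lookup f m))"
  by (rule poly_mapping_eqI)
    (auto simp: lookup_sum lookup_single when_def in_keys_iff if_distrib cong: if_cong)

lemma poly_eval_mult: "poly_eval x (f * g) = poly_eval x f * poly_eval x g"
proof -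
  have "f * g = (\<Sum>a\<in>Poly_Mapping.keys f. \<Sum>b\<in>Poly_Mapping.keys g.
      Poly_Mapping.single (a + b) (Poly_Mapping.lookup f a * Poly_Mapping.lookup g b))"
    by (subst rpoly_expansion[of f], subst rpoly_expansion[of g]) (simp add: sum_product mult_single)
  then have "poly_eval x (f * g) = (\<Sum>a\<in>Poly_Mapping.keys f. \<Sum>b\<in>Poly_Mapping.keys g.
      (Poly_Mapping.lookup f a * monom_eval x a) * (Poly_Mapping.lookup g b * monom_eval x b))"
    by (simp add: poly_eval_sum poly_eval_single monom_eval_add mult_ac)
  then show ?thesis
    by (simp add: poly_eval_def sum_product)
qed

end

theory Submission
  imports Defs "HOL-Library.Sublist"
begin

text \<open>
  Read a point \<open>x\<close> as a weighting of the root-to-leaf paths, and let the \<^emph>\<open>mass\<close> of a vertex be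
  the total weight of the paths through it, which is the value of its vertex polynomial at \<open>x\<close>.
  For any \<open>x\<close> the mass flows down the tree: a non-leaf passes its mass on to its children without
  loss (\<open>mass_children\<close>), and the mass of a leaf is the weight of the single path that ends there
  (\<open>mass_leaf\<close>).

  If \<open>x\<close> comes from parameters \<open>\<theta>\<close>, then induction from the leaves upwards shows that the mass of a
  vertex is the product of \<open>\<theta>\<close> along the path to it (\<open>mass_of_product\<close>); the factors below the
  vertex sum to one. So the child along an arc \<open>e\<close> receives the fraction \<open>\<theta> (label e)\<close> of the mass
  of its parent. This fraction depends only on the label, and that is precisely what the
  generators of the ideal express.

  Conversely, let the generators vanish at a point \<open>x\<close> of the open simplex. All masses are positive,
  so the fraction of mass that is sent along an arc is defined, and arcs with equal labels have
  equal fractions: their tails are in the same stage, because different stages have disjoint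
  label sets. These common fractions are parameters, and the product of the fractions along a path
  from the root telescopes to the mass of its last vertex divided by the total mass \<open>1\<close>. At a
  leaf this recovers \<open>x\<close>.
\<close>

section \<open>The zero set of a generated ideal\<close>

lemma poly_eval_diff: "poly_eval x (f - g) = poly_eval x f - poly_eval x g"
  using poly_eval_add[of x "f - g" g] by simp

lemma poly_ring_simps:
  "f \<oplus>\<^bsub>poly_ring n\<^esub> g = f + g" "f \<otimes>\<^bsub>poly_ring n\<^esub> g = f * g" "\<zero>\<^bsub>poly_ring n\<^esub> = 0"
  by (simp_all add: poly_ring_def)

text \<open>
  This is the kernel of evaluation at \<open>x\<close>, so a generated ideal vanishes at \<open>x\<close> as soon as its
  generators do.
\<close>
lemma vanishing_ideal: "ideal {f \<in> carrier (poly_ring n). poly_eval x f = 0} (poly_ring n)"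
proof -
  interpret R: cring "poly_ring n" by (rule poly_ring_cring)
  have neg: "poly_eval x (\<ominus>\<^bsub>poly_ring n\<^esub> f) = - poly_eval x f" if "f \<in> carrier (poly_ring n)" for f
    using R.r_neg[OF that] poly_eval_add[of x f "\<ominus>\<^bsub>poly_ring n\<^esub> f"]
    by (simp add: poly_ring_simps poly_eval_0)
  show ?thesis
  proof (rule idealI[OF R.ring_axioms])
    show "subgroup {f \<in> carrier (poly_ring n). poly_eval x f = 0} (add_monoid (poly_ring n))"
    proof (rule R.add.subgroupI)
      show "{f \<in> carrier (poly_ring n). poly_eval x f = 0} \<noteq> {}"
        using R.zero_closed by (auto simp: poly_ring_simps poly_eval_0)
    next
      fix f g
      assume "f \<in> {f \<in> carrier (poly_ring n). poly_eval x f = 0}"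
        and "g \<in> {f \<in> carrier (poly_ring n). poly_eval x f = 0}"
      then show "f \<oplus>\<^bsub>poly_ring n\<^esub> g \<in> {f \<in> carrier (poly_ring n). poly_eval x f = 0}"
        using R.a_closed[of f g] by (simp add: poly_ring_simps poly_eval_add)
    qed (auto simp: neg)
  next
    fix f g
    assume f: "f \<in> {f \<in> carrier (poly_ring n). poly_eval x f = 0}"
      and g: "g \<in> carrier (poly_ring n)"
    show "g \<otimes>\<^bsub>poly_ring n\<^esub> f \<in> {f \<in> carrier (poly_ring n). poly_eval x f = 0}"
      using f g R.m_closed[of g f] by (simp add: poly_ring_simps poly_eval_mult)
    show "f \<otimes>\<^bsub>poly_ring n\<^esub> g \<in> {f \<in> carrier (poly_ring n). poly_eval x f = 0}"
      using f g R.m_closed[of f g] by (simp add: poly_ring_simps poly_eval_mult)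
  qed
qed

lemma variety_genideal:
  assumes "S \<subseteq> carrier (poly_ring n)"
  shows "variety n (genideal (poly_ring n) S) = {x \<in> {1..n} \<rightarrow>\<^sub>E UNIV. \<forall>f\<in>S. poly_eval x f = 0}"
proof -
  interpret R: cring "poly_ring n" by (rule poly_ring_cring)
  have "S \<subseteq> genideal (poly_ring n) S"
    by (rule R.genideal_self[OF assms])
  moreover have "genideal (poly_ring n) S \<subseteq> {f \<in> carrier (poly_ring n). poly_eval x f = 0}"
    if "\<forall>f\<in>S. poly_eval x f = 0" for x
    using that assms by (intro R.genideal_minimal vanishing_ideal) blast
  ultimately show ?thesis
    unfolding variety_def by blast
qed

lemma var_sum_in_carrier:
  assumes "A \<subseteq> {1..n}"
  shows "(\<Sum>i\<in>A. var i) \<in> carrier (poly_ring n)"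
proof -
  interpret R: cring "poly_ring n" by (rule poly_ring_cring)
  show ?thesis
    using assms
  proof (induction A rule: infinite_finite_induct)
    case (insert i A)
    moreover have "var i \<in> carrier (poly_ring n)"
      using insert.prems by (simp add: var_def poly_ring_def)
    ultimately show ?case
      using R.a_closed[of "var i" "\<Sum>i\<in>A. var i"] by (simp add: poly_ring_simps)
  qed (use R.zero_closed in \<open>simp_all add: poly_ring_simps\<close>)
qed

lemma poly_ring_mult_diff_closed:
  assumes "a \<in> carrier (poly_ring n)" "b \<in> carrier (poly_ring n)"
    and "c \<in> carrier (poly_ring n)" "d \<in> carrier (poly_ring n)"
  shows "a * b - c * d \<in> carrier (poly_ring n)"
proof -
  interpret R: cring "poly_ring n" by (rule poly_ring_cring)
  have prods: "a * b \<in> carrier (poly_ring n)" "c * d \<in> carrier (poly_ring n)"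
    using R.m_closed[of a b] R.m_closed[of c d] assms by (simp_all add: poly_ring_simps)
  then have "- (c * d) \<in> carrier (poly_ring n)"
    by (simp add: poly_ring_def)
  then have "a * b \<oplus>\<^bsub>poly_ring n\<^esub> - (c * d) \<in> carrier (poly_ring n)"
    by (rule R.a_closed[OF prods(1)])
  then show ?thesis
    by (simp add: poly_ring_simps)
qed

section \<open>Paths from the root\<close>

context rooted_tree
begin

definition path_to :: "'v \<Rightarrow> 'e awalk" where
  "path_to v = (THE p. awalk v0 p v)"

lemma awalk_root_iff: "awalk v0 p v \<longleftrightarrow> v \<in> verts T \<and> p = path_to v"
proof -
  have "awalk v0 (path_to v) v" if "v \<in> verts T"
    unfolding path_to_def by (rule theI'[OF unique_awalk[OF that]])
  then show ?thesis
    using unique_awalk[of v] awalk_last_in_verts by metis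
qed

lemma awalk_after_path_to:
  assumes "v \<in> verts T" "awalk v0 (path_to v @ q) w"
  shows "awalk v q w"
proof -
  have "awalk v0 (path_to v) v"
    using assms(1) by (simp add: awalk_root_iff)
  then show ?thesis
    using assms(2) by simp
qed

lemma path_to_root: "path_to v0 = []"
  using awalk_root_iff[of "[]" v0] root_in_verts by (simp add: awalk_Nil_iff)

lemma path_to_head:
  assumes "e \<in> arcs T"
  shows "path_to (head T e) = path_to (tail T e) @ [e]"
proof -
  have "awalk v0 (path_to (tail T e)) (tail T e)"
    using assms by (simp add: awalk_root_iff)
  then have "awalk v0 (path_to (tail T e) @ [e]) (head T e)"
    using assms by (auto intro: awalk_appendI arc_implies_awalk)
  then show ?thesis
    using awalk_root_iff by metis
qed

lemma root_down_induct [consumes 1, case_names root child]: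
  assumes "v \<in> verts T" and "P v0"
    and "\<And>e. e \<in> arcs T \<Longrightarrow> P (tail T e) \<Longrightarrow> P (head T e)"
  shows "P v"
proof -
  have "P v" if "awalk v0 p v" for p
    using that
  proof (induction p arbitrary: v rule: rev_induct)
    case Nil
    then show ?case using assms(2) by (simp add: awalk_Nil_iff)
  next
    case (snoc e p)
    then show ?case using assms(3)[of e] by (auto simp: awalk_simps)
  qed
  then show ?thesis
    using assms(1) awalk_root_iff by blast
qed

text \<open>
  A second visit to an arc would give a second, longer walk from the root to its tail.
\<close>
lemma arc_notin_path_to_tail:
  assumes "e \<in> arcs T"
  shows "e \<notin> set (path_to (tail T e))"
proof
  assume "e \<in> set (path_to (tail T e))"
  then obtain p q where pq: "path_to (tail T e) = p @ e # q"
    by (meson split_list)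
  have "awalk v0 (p @ e # q) (tail T e)"
    using assms pq[symmetric] by (simp add: awalk_root_iff)
  then have "awalk v0 p (tail T e)"
    by (auto simp: awalk_simps)
  then show False
    using pq by (simp add: awalk_root_iff)
qed

lemma distinct_path_to: "v \<in> verts T \<Longrightarrow> distinct (path_to v)"
  by (induction v rule: root_down_induct)
    (simp_all add: path_to_root path_to_head arc_notin_path_to_tail)

lemma path_to_subset_arcs: "v \<in> verts T \<Longrightarrow> set (path_to v) \<subseteq> arcs T"
  using awalk_root_iff[of "path_to v" v] by auto

text \<open>
  Paths from the root have distinct arcs, so they cannot be longer than the number of arcs; hence
  the induction from the leaves upwards is well-founded.
\<close>
lemma leaves_up_induct [consumes 1, case_names step]:
  assumes "v \<in> verts T"
    and "\<And>v. v \<in> verts T \<Longrightarrow> (\<And>e. e \<in> out_arcs T v \<Longrightarrow> P (head T e)) \<Longrightarrow> P v"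
  shows "P v"
  using assms(1)
proof (induction "card (arcs T) - length (path_to v)" arbitrary: v rule: less_induct)
  case less
  show ?case
  proof (rule assms(2)[OF less.prems])
    fix e assume e: "e \<in> out_arcs T v"
    then have head: "head T e \<in> verts T" "path_to (head T e) = path_to v @ [e]"
      using path_to_head[of e] by auto
    have "length (path_to (head T e)) = card (set (path_to (head T e)))"
      using head(1) by (simp add: distinct_card distinct_path_to)
    also have "\<dots> \<le> card (arcs T)"
      using head(1) by (intro card_mono path_to_subset_arcs finite_arcs)
    finally show "P (head T e)"
      using head by (intro less.hyps) auto
  qed
qed

text \<open>
  Since the walk from the root to \<open>v\<close> is unique, passing through a vertex is a property of arc
  lists: it means starting with \<open>path_to v\<close>.
\<close>
lemma on_root_walk_iff_prefix:
  assumes "awalk v0 p w"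
  shows "v \<in> set (awalk_verts v0 p) \<longleftrightarrow> v \<in> verts T \<and> prefix (path_to v) p"
proof
  assume "v \<in> set (awalk_verts v0 p)"
  then show "v \<in> verts T \<and> prefix (path_to v) p"
    using awalk_decomp[OF assms] awalk_root_iff by (metis prefixI)
next
  assume v: "v \<in> verts T \<and> prefix (path_to v) p"
  then obtain q where p: "p = path_to v @ q"
    by (auto elim: prefixE)
  have "awalk v0 (path_to v) v"
    using v by (simp add: awalk_root_iff)
  then have "v \<in> set (awalk_verts v0 (path_to v))"
    using last_in_set[OF awalk_verts_non_Nil[of v0 "path_to v"]] by simp
  moreover have "awalk v q w"
    using assms v p by (simp add: awalk_after_path_to)
  ultimately show "v \<in> set (awalk_verts v0 p)"
    using set_awalk_verts_append[of v0 "path_to v" v q w] \<open>awalk v0 (path_to v) v\<close> p by simp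
qed

end

section \<open>Mass flowing down the tree\<close>

locale numbered_tree = rooted_tree T v0
  for T :: "('v, 'e) pre_digraph" and v0 :: 'v +
  fixes n :: nat and walk :: "nat \<Rightarrow> 'e awalk"
  assumes bij_walk: "bij_betw walk {1..n} (root_leaf_paths T v0)"
begin

abbreviation through :: "'v \<Rightarrow> nat set" where
  "through \<equiv> paths_through T v0 n walk"

definition mass :: "(nat \<Rightarrow> real) \<Rightarrow> 'v \<Rightarrow> real" where
  "mass x v = (\<Sum>i\<in>through v. x i)"

lemma poly_eval_vertex_poly: "poly_eval x (vertex_poly T v0 n walk v) = mass x v"
  by (simp add: vertex_poly_def mass_def poly_eval_sum poly_eval_var)

lemma walk_leaf:
  assumes "i \<in> {1..n}"
  obtains l where "l \<in> verts T - non_leaves T" "walk i = path_to l"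
proof -
  have "walk i \<in> root_leaf_paths T v0"
    using bij_walk assms by (auto simp: bij_betw_def)
  then show thesis
    using that by (auto simp: root_leaf_paths_def awalk_root_iff)
qed

lemma leaf_walk:
  assumes "l \<in> verts T - non_leaves T"
  obtains i where "i \<in> {1..n}" "walk i = path_to l"
proof -
  have "path_to l \<in> root_leaf_paths T v0"
    using assms by (auto simp: root_leaf_paths_def awalk_root_iff)
  then have "path_to l \<in> walk ` {1..n}"
    using bij_walk by (simp add: bij_betw_def)
  then show thesis
    using that by (metis imageE)
qed

lemma through_iff_prefix:
  assumes "v \<in> verts T"
  shows "i \<in> through v \<longleftrightarrow> i \<in> {1..n} \<and> prefix (path_to v) (walk i)"
proof (cases "i \<in> {1..n}")
  case True
  then obtain l where "l \<in> verts T - non_leaves T" "walk i = path_to l"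
    by (rule walk_leaf)
  then have "awalk v0 (walk i) l"
    by (simp add: awalk_root_iff)
  then show ?thesis
    using on_root_walk_iff_prefix[of "walk i" l v] True assms by (simp add: paths_through_def)
qed (auto simp: paths_through_def)

lemma through_subset: "through v \<subseteq> {1..n}"
  by (auto simp: paths_through_def)

lemma finite_through: "finite (through v)"
  using through_subset by (rule finite_subset) simp

lemma through_root: "through v0 = {1..n}"
  by (auto simp: through_iff_prefix[OF root_in_verts] path_to_root)

text \<open>A path that reaches a leaf cannot continue, so it is the path to this leaf.\<close>
lemma through_leaf:
  assumes "i \<in> {1..n}" "walk i = path_to l" and l: "l \<in> verts T - non_leaves T"
  shows "through l = {i}"
proof -
  have "walk j = path_to l" if j: "j \<in> {1..n}" "prefix (path_to l) (walk j)" for j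
  proof -
    from j(1) obtain k where k: "k \<in> verts T - non_leaves T" "walk j = path_to k"
      by (rule walk_leaf)
    from j(2) obtain q where q: "walk j = path_to l @ q"
      by (auto elim: prefixE)
    have "awalk v0 (path_to l @ q) k"
      using k q[symmetric] by (simp add: awalk_root_iff)
    then have "awalk l q k"
      using l awalk_after_path_to by blast
    have "q = []"
    proof (rule ccontr)
      assume "q \<noteq> []"
      then obtain e r where "q = e # r"
        by (cases q) auto
      then have "e \<in> out_arcs T l"
        using \<open>awalk l q k\<close> by (simp add: awalk_simps)
      then show False
        using l unfolding non_leaves_def by blast
    qed
    then show ?thesis using q by simp
  qed
  moreover have "inj_on walk {1..n}"
    using bij_walk by (simp add: bij_betw_def)
  ultimately have "j = i" if "j \<in> {1..n}" "prefix (path_to l) (walk j)" for j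
    using assms(1,2) that by (metis inj_onD)
  moreover have "i \<in> through l"
    using assms by (simp add: through_iff_prefix)
  moreover have "j \<in> {1..n} \<and> prefix (path_to l) (walk j)" if "j \<in> through l" for j
    using that l by (simp add: through_iff_prefix)
  ultimately show ?thesis by blast
qed

text \<open>
  A root-to-leaf path through a non-leaf does not end there, so it continues along some arc.
\<close>
lemma through_children:
  assumes v: "v \<in> non_leaves T"
  shows "through v = (\<Union>e\<in>out_arcs T v. through (head T e))"
proof -
  have verts: "v \<in> verts T" "\<And>e. e \<in> out_arcs T v \<Longrightarrow> head T e \<in> verts T"
    using v by (auto simp: non_leaves_def)
  have "\<exists>e\<in>out_arcs T v. i \<in> through (head T e)" if i: "i \<in> through v" for i
  proof -
    have i': "i \<in> {1..n}" "prefix (path_to v) (walk i)"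
      using i by (auto simp: through_iff_prefix[OF verts(1)])
    from i'(1) obtain l where l: "l \<in> verts T - non_leaves T" "walk i = path_to l"
      by (rule walk_leaf)
    from i'(2) obtain q where q: "walk i = path_to v @ q"
      by (auto elim: prefixE)
    have "awalk v0 (path_to v @ q) l"
      using l q[symmetric] by (simp add: awalk_root_iff)
    then have walk_q: "awalk v q l"
      by (rule awalk_after_path_to[OF verts(1)])
    then have "q \<noteq> []"
      using l(1) v by (auto simp: awalk_simps)
    then obtain e r where er: "q = e # r"
      by (cases q) auto
    then have e: "e \<in> out_arcs T v"
      using walk_q by (auto simp: awalk_simps)
    then have "prefix (path_to (head T e)) (walk i)"
      using q er path_to_head[of e] by simp
    then show ?thesis
      using e i'(1) verts(2) through_iff_prefix by blast
  qed
  moreover have "i \<in> through v" if "e \<in> out_arcs T v" "i \<in> through (head T e)" for i e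
    using that verts path_to_head[of e]
    by (auto simp: through_iff_prefix dest: append_prefixD)
  ultimately show ?thesis by blast
qed

lemma disjoint_through_children:
  assumes "e \<in> out_arcs T v" "f \<in> out_arcs T v" "e \<noteq> f"
  shows "through (head T e) \<inter> through (head T f) = {}"
proof -
  have "\<not> (prefix (path_to v @ [e]) p \<and> prefix (path_to v @ [f]) p)" for p
    using assms(3) by (auto simp: prefix_def)
  then show ?thesis
    using assms by (auto simp: through_iff_prefix path_to_head)
qed

lemma through_nonempty: "v \<in> verts T \<Longrightarrow> through v \<noteq> {}"
proof (induction v rule: leaves_up_induct)
  case (step v)
  show ?case
  proof (cases "v \<in> non_leaves T")
    case True
    then obtain e where e: "e \<in> out_arcs T v"
      unfolding non_leaves_def by blast
    then have "through (head T e) \<subseteq> through v"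
      unfolding through_children[OF True] by blast
    then show ?thesis
      using step.IH[OF e] by blast
  next
    case False
    then have v: "v \<in> verts T - non_leaves T"
      using step.hyps by blast
    obtain i where "i \<in> {1..n}" "walk i = path_to v"
      by (rule leaf_walk[OF v])
    then show ?thesis
      using through_leaf v by blast
  qed
qed

lemma mass_root: "mass x v0 = (\<Sum>i=1..n. x i)"
  by (simp add: mass_def through_root)

lemma mass_leaf:
  assumes "i \<in> {1..n}" "walk i = path_to l" "l \<in> verts T - non_leaves T"
  shows "mass x l = x i"
  by (simp add: mass_def through_leaf[OF assms])

lemma mass_children:
  assumes "v \<in> non_leaves T"
  shows "mass x v = (\<Sum>e\<in>out_arcs T v. mass x (head T e))"
  unfolding mass_def through_children[OF assms]
  by (intro sum.UNION_disjoint ballI impI finite_through finite_out_arcs)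
    (rule disjoint_through_children)

lemma mass_pos:
  assumes "\<And>i. i \<in> {1..n} \<Longrightarrow> 0 < x i" "v \<in> verts T"
  shows "0 < mass x v"
  unfolding mass_def
  using assms(1) through_subset[of v]
  by (intro sum_pos finite_through through_nonempty[OF assms(2)]) blast

text \<open>
  If the weight of each root-to-leaf path is the product of its arc fractions, then the fractions
  below a vertex can be summed out, and only those above it remain in its mass.
\<close>
lemma mass_of_product:
  assumes fractions: "\<And>v. v \<in> non_leaves T \<Longrightarrow> (\<Sum>e\<in>out_arcs T v. \<phi> e) = 1"
    and x: "\<And>i. i \<in> {1..n} \<Longrightarrow> x i = (\<Prod>e\<in>set (walk i). \<phi> e)"
    and "v \<in> verts T"
  shows "mass x v = (\<Prod>e\<in>set (path_to v). \<phi> e)"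
  using assms(3)
proof (induction v rule: leaves_up_induct)
  case (step v)
  show ?case
  proof (cases "v \<in> non_leaves T")
    case True
    have "mass x v = (\<Sum>e\<in>out_arcs T v. \<Prod>e\<in>set (path_to (head T e)). \<phi> e)"
      using step.IH by (simp add: mass_children[OF True])
    also have "\<dots> = (\<Sum>e\<in>out_arcs T v. \<phi> e * (\<Prod>e\<in>set (path_to v). \<phi> e))"
    proof (rule sum.cong)
      fix e assume "e \<in> out_arcs T v"
      then show "(\<Prod>e\<in>set (path_to (head T e)). \<phi> e) = \<phi> e * (\<Prod>e\<in>set (path_to v). \<phi> e)"
        using arc_notin_path_to_tail[of e] path_to_head[of e] by auto
    qed simp
    also have "\<dots> = (\<Prod>e\<in>set (path_to v). \<phi> e)"
      using fractions[OF True] by (simp flip: sum_distrib_right)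
    finally show ?thesis .
  next
    case False
    then have v: "v \<in> verts T - non_leaves T"
      using step.hyps by blast
    obtain i where "i \<in> {1..n}" "walk i = path_to v"
      by (rule leaf_walk[OF v])
    then show ?thesis
      using mass_leaf v x by simp
  qed
qed

lemma telescoping_mass:
  assumes x_pos: "\<And>i. i \<in> {1..n} \<Longrightarrow> 0 < x i" and "v \<in> verts T"
  shows "(\<Prod>e\<in>set (path_to v). mass x (head T e) / mass x (tail T e)) = mass x v / mass x v0"
  using assms(2)
proof (induction v rule: root_down_induct)
  case root
  have "mass x v0 \<noteq> 0"
    using mass_pos[of x v0] x_pos root_in_verts by fastforce
  then show ?case
    by (simp add: path_to_root)
next
  case (child e)
  have "mass x (tail T e) \<noteq> 0"
    using mass_pos[of x "tail T e"] x_pos child.hyps by fastforce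
  let ?\<phi> = "\<lambda>e. mass x (head T e) / mass x (tail T e)"
  have "(\<Prod>f\<in>set (path_to (head T e)). ?\<phi> f) = ?\<phi> e * (\<Prod>f\<in>set (path_to (tail T e)). ?\<phi> f)"
    using child.hyps arc_notin_path_to_tail[of e] by (simp add: path_to_head)
  also have "\<dots> = ?\<phi> e * (mass x (tail T e) / mass x v0)"
    by (simp only: child.IH)
  also have "\<dots> = mass x (head T e) / mass x v0"
    using \<open>mass x (tail T e) \<noteq> 0\<close> by simp
  finally show ?case .
qed

end

section \<open>Staged trees and their invariants\<close>

locale numbered_staged_tree =
  staged_tree T v0 label stage + numbered_tree T v0 n walk
  for T :: "('v, 'e) pre_digraph" and v0 :: 'v
    and label :: "'e \<Rightarrow> 'l" and stage :: "('v \<times> 'v) set"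
    and n :: nat and walk :: "nat \<Rightarrow> 'e awalk"
begin

text \<open>
  Different stages have disjoint label sets. Hence a label determines the stage in which its arcs
  start, and the invariants compare all arcs with a common label.
\<close>
lemma same_label_same_stage:
  assumes "e \<in> arcs T" "f \<in> arcs T" "label e = label f"
  shows "(tail T e, tail T f) \<in> stage"
proof (rule ccontr)
  assume "(tail T e, tail T f) \<notin> stage"
  moreover have "tail T e \<in> non_leaves T" "tail T f \<in> non_leaves T"
    using assms by (auto simp: non_leaves_def)
  ultimately have "label ` out_arcs T (tail T e) \<inter> label ` out_arcs T (tail T f) = {}"
    by (intro other_stage)
  moreover have "label e \<in> label ` out_arcs T (tail T e)"
    using assms(1) by simp
  moreover have "label e \<in> label ` out_arcs T (tail T f)"
    using assms(2) unfolding assms(3) by simp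
  ultimately show False by blast
qed

lemma in_variety_iff:
  "x \<in> variety n (invariant_ideal T v0 label stage n walk) \<longleftrightarrow>
    x \<in> {1..n} \<rightarrow>\<^sub>E UNIV \<and>
    (\<forall>e\<in>arcs T. \<forall>f\<in>arcs T. label e = label f \<longrightarrow>
      mass x (tail T e) * mass x (head T f) = mass x (head T e) * mass x (tail T f))"
proof -
  let ?p = "vertex_poly T v0 n walk"
  let ?S = "{?p v * ?p (head T f) - ?p (head T e) * ?p w | v w e f.
    (v, w) \<in> stage \<and> e \<in> out_arcs T v \<and> f \<in> out_arcs T w \<and> label e = label f}"
  have "?p v \<in> carrier (poly_ring n)" for v
    unfolding vertex_poly_def by (intro var_sum_in_carrier through_subset)
  then have "?S \<subseteq> carrier (poly_ring n)"
    by (auto intro: poly_ring_mult_diff_closed)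
  then have "x \<in> variety n (invariant_ideal T v0 label stage n walk) \<longleftrightarrow>
      x \<in> {1..n} \<rightarrow>\<^sub>E UNIV \<and> (\<forall>f\<in>?S. poly_eval x f = 0)"
    by (simp add: invariant_ideal_def Let_def variety_genideal)
  also have "?S = {?p (tail T e) * ?p (head T f) - ?p (head T e) * ?p (tail T f) | e f.
      e \<in> arcs T \<and> f \<in> arcs T \<and> label e = label f}"
    using same_label_same_stage by fastforce
  finally show ?thesis
    by (fastforce simp: poly_eval_diff poly_eval_mult poly_eval_vertex_poly)
qed

text \<open>The path to the head of any arc is nonempty, and its first arc leaves the root.\<close>
lemma root_non_leaf: "v0 \<in> non_leaves T"
proof -
  obtain e where e: "e \<in> arcs T"
    using arcs_nonempty by blast
  obtain f p where fp: "path_to (head T e) = f # p"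
    using path_to_head[OF e] by (metis append_is_Nil_conv list.exhaust not_Cons_self2)
  have "awalk v0 (f # p) (head T e)"
    using e fp by (simp add: awalk_root_iff)
  then have "f \<in> out_arcs T v0"
    by (simp add: awalk_simps)
  then show ?thesis
    using root_in_verts unfolding non_leaves_def by blast
qed

lemma model_subset:
  "staged_tree_model T label n walk \<subseteq>
    variety n (invariant_ideal T v0 label stage n walk) \<inter> open_simplex n"
proof
  fix x assume "x \<in> staged_tree_model T label n walk"
  then obtain \<theta> where \<theta>: "\<theta> \<in> parameter_space T label"
    and x_def: "x = (\<lambda>i\<in>{1..n}. \<Prod>e\<in>set (walk i). \<theta> (label e))"
    by (auto simp: staged_tree_model_def)
  have x: "x i = (\<Prod>e\<in>set (walk i). \<theta> (label e))" if "i \<in> {1..n}" for i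
    using that by (simp add: x_def)
  have sum1: "(\<Sum>e\<in>out_arcs T v. \<theta> (label e)) = 1" if "v \<in> non_leaves T" for v
    using \<theta> that by (simp add: parameter_space_def)
  have \<theta>01: "0 < \<theta> (label e) \<and> \<theta> (label e) < 1" if "e \<in> arcs T" for e
    using \<theta> that by (auto simp: parameter_space_def dest!: PiE_mem[of _ _ _ "label e"])
  have mass: "mass x v = (\<Prod>e\<in>set (path_to v). \<theta> (label e))" if "v \<in> verts T" for v
    using mass_of_product[of "\<lambda>e. \<theta> (label e)"] sum1 x that by blast
  have mass_head: "mass x (head T e) = mass x (tail T e) * \<theta> (label e)" if "e \<in> arcs T" for e
    using that arc_notin_path_to_tail[OF that] by (simp add: mass path_to_head)
  have "x \<in> variety n (invariant_ideal T v0 label stage n walk)"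
    unfolding in_variety_iff
  proof (intro conjI ballI impI)
    fix e f assume "e \<in> arcs T" "f \<in> arcs T" "label e = label f"
    then show "mass x (tail T e) * mass x (head T f) = mass x (head T e) * mass x (tail T f)"
      by (simp add: mass_head)
  qed (simp add: x_def)
  moreover have "x \<in> open_simplex n"
    unfolding open_simplex_def
  proof (intro CollectI conjI ballI)
    show "x \<in> {1..n} \<rightarrow>\<^sub>E UNIV"
      by (simp add: x_def)
    show "(\<Sum>i=1..n. x i) = 1"
      using mass_root[of x] mass[OF root_in_verts] by (simp add: path_to_root)
  next
    fix i assume i: "i \<in> {1..n}"
    then obtain l where l: "l \<in> verts T - non_leaves T" "walk i = path_to l"
      by (rule walk_leaf)
    have arcs: "set (walk i) \<subseteq> arcs T"
      using l path_to_subset_arcs by simp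
    then show "0 < x i"
      using \<theta>01 by (auto simp: x[OF i] intro!: prod_pos)
    have "walk i \<noteq> []"
    proof
      assume "walk i = []"
      then have "awalk v0 [] l"
        using l by (simp add: awalk_root_iff)
      then show False
        using l(1) root_non_leaf by (simp add: awalk_Nil_iff)
    qed
    then have "hd (walk i) \<in> arcs T"
      using arcs hd_in_set by blast
    then have "(\<Prod>e\<in>set (walk i). \<theta> (label e)) < (\<Prod>e\<in>set (walk i). 1)"
      using arcs \<theta>01 \<open>walk i \<noteq> []\<close>
      by (intro prod_mono_strict[of "hd (walk i)"]) (auto intro: less_imp_le)
    then show "x i < 1"
      by (simp add: x[OF i])
  qed
  ultimately show "x \<in> variety n (invariant_ideal T v0 label stage n walk) \<inter> open_simplex n"
    by blast
qed

lemma positive_variety_subset: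
  "variety n (invariant_ideal T v0 label stage n walk) \<inter> open_simplex n \<subseteq>
    staged_tree_model T label n walk"
proof
  fix x assume "x \<in> variety n (invariant_ideal T v0 label stage n walk) \<inter> open_simplex n"
  then have inv: "\<And>e f. e \<in> arcs T \<Longrightarrow> f \<in> arcs T \<Longrightarrow> label e = label f \<Longrightarrow>
      mass x (tail T e) * mass x (head T f) = mass x (head T e) * mass x (tail T f)"
    and ext: "x \<in> {1..n} \<rightarrow>\<^sub>E UNIV" and total: "(\<Sum>i=1..n. x i) = 1"
    and x_pos: "\<And>i. i \<in> {1..n} \<Longrightarrow> 0 < x i"
    by (simp_all add: in_variety_iff open_simplex_def)
  have pos: "0 < mass x v" if "v \<in> verts T" for v
    using mass_pos[of x v] x_pos that by blast
  define frac where "frac e = mass x (head T e) / mass x (tail T e)" for e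
  \<comment> \<open>Any representative arc of a label will do, by \<open>frac_eq\<close> below.\<close>
  define \<theta> where "\<theta> = (\<lambda>l\<in>label ` arcs T. frac (SOME e. e \<in> arcs T \<and> label e = l))"
  have frac_eq: "frac e = frac f" if "e \<in> arcs T" "f \<in> arcs T" "label e = label f" for e f
  proof -
    have "mass x (tail T e) \<noteq> 0" "mass x (tail T f) \<noteq> 0"
      using pos[of "tail T e"] pos[of "tail T f"] that by auto
    then show ?thesis
      unfolding frac_def using inv[OF that] by (simp add: frac_eq_eq mult.commute)
  qed
  have \<theta>_label: "\<theta> (label e) = frac e" if "e \<in> arcs T" for e
  proof -
    let ?f = "SOME f. f \<in> arcs T \<and> label f = label e"
    have f: "?f \<in> arcs T \<and> label ?f = label e"
      by (rule someI[of _ e]) (simp add: that)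
    have "\<theta> (label e) = frac ?f"
      using that by (simp add: \<theta>_def)
    also have "\<dots> = frac e"
      using f that by (intro frac_eq) simp_all
    finally show ?thesis .
  qed
  have frac_sum: "(\<Sum>e\<in>out_arcs T v. frac e) = 1" if v: "v \<in> non_leaves T" for v
  proof -
    have "(\<Sum>e\<in>out_arcs T v. frac e) = (\<Sum>e\<in>out_arcs T v. mass x (head T e)) / mass x v"
      by (simp add: frac_def sum_divide_distrib)
    then show ?thesis
      using pos[of v] v by (simp add: non_leaves_def flip: mass_children[OF v])
  qed
  have frac_pos: "0 < frac e" if "e \<in> arcs T" for e
    using that pos by (simp add: frac_def)
  \<comment> \<open>An arc has a sibling, which takes a positive fraction as well.\<close>
  have frac_less: "frac e < 1" if e: "e \<in> arcs T" for e
  proof -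
    let ?A = "out_arcs T (tail T e)"
    have e_A: "e \<in> ?A" and fin: "finite ?A"
      using e by (simp_all add: finite_out_arcs)
    have "card ?A \<noteq> 0"
      using card_gt_0_iff[of ?A] e_A fin by blast
    then have "card ?A \<ge> 2"
      using out_degree[of "tail T e"] e unfolding out_degree_def by simp
    then have "card (?A - {e}) > 0"
      using e_A by simp
    then have "?A - {e} \<noteq> {}"
      unfolding card_gt_0_iff by blast
    then have "0 < (\<Sum>f\<in>?A - {e}. frac f)"
      using fin frac_pos by (intro sum_pos) simp_all
    moreover have "(\<Sum>f\<in>?A. frac f) = frac e + (\<Sum>f\<in>?A - {e}. frac f)"
      using fin e_A by (rule sum.remove)
    moreover have "(\<Sum>f\<in>?A. frac f) = 1"
    proof (rule frac_sum)
      show "tail T e \<in> non_leaves T"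
        unfolding non_leaves_def using e_A tail_in_verts[OF e] by blast
    qed
    ultimately show ?thesis by simp
  qed
  have "(\<Sum>e\<in>out_arcs T v. \<theta> (label e)) = 1" if "v \<in> non_leaves T" for v
    using frac_sum[OF that] by (simp add: \<theta>_label)
  moreover have "\<theta> \<in> label ` arcs T \<rightarrow>\<^sub>E {0<..<1}"
  proof (rule PiE_I)
    fix l assume "l \<in> label ` arcs T"
    then obtain e where "e \<in> arcs T" "l = label e"
      by blast
    then show "\<theta> l \<in> {0<..<1}"
      using frac_pos[of e] frac_less[of e] by (simp add: \<theta>_label)
  qed (simp add: \<theta>_def)
  ultimately have \<theta>_param: "\<theta> \<in> parameter_space T label"
    by (simp add: parameter_space_def)
  have "x = (\<lambda>i\<in>{1..n}. \<Prod>e\<in>set (walk i). \<theta> (label e))"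
  proof (rule extensionalityI[where A = "{1..n}"])
    show "x \<in> extensional {1..n}"
      using ext by (simp add: PiE_iff)
  next
    fix i assume i: "i \<in> {1..n}"
    then obtain l where l: "l \<in> verts T - non_leaves T" "walk i = path_to l"
      by (rule walk_leaf)
    have "(\<Prod>e\<in>set (walk i). \<theta> (label e)) = (\<Prod>e\<in>set (path_to l). frac e)"
      using l path_to_subset_arcs[of l] by (intro prod.cong) (auto intro!: \<theta>_label)
    also have "\<dots> = mass x l / mass x v0"
      unfolding frac_def using telescoping_mass[of x l] x_pos l(1) by blast
    also have "\<dots> = x i"
      using mass_leaf[OF i l(2) l(1)] mass_root[of x] total by simp
    finally show "x i = (\<lambda>i\<in>{1..n}. \<Prod>e\<in>set (walk i). \<theta> (label e)) i"
      using i by simp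
  qed simp
  then show "x \<in> staged_tree_model T label n walk"
    using \<theta>_param by (auto simp: staged_tree_model_def)
qed

end

theorem theorem3:
  fixes T :: "('v, 'e) pre_digraph" and v0 :: 'v
    and label :: "'e \<Rightarrow> 'l" and stage :: "('v \<times> 'v) set"
    and n :: nat and walk :: "nat \<Rightarrow> 'e awalk"
  assumes "staged_tree T v0 label stage"
    and "bij_betw walk {1..n} (root_leaf_paths T v0)"
  shows "staged_tree_model T label n walk =
    variety n (invariant_ideal T v0 label stage n walk) \<inter> open_simplex n"
proof -
  interpret staged_tree T v0 label stage by fact
  interpret numbered_staged_tree T v0 label stage n walk
    by unfold_locales fact
  show ?thesis
    using model_subset positive_variety_subset by (rule subset_antisym)
qed

end
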